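(* Let $F$ be a field of characteristic two and let $t\in F$. Then the polynomial $x^2+x+t$ is solvable in Chebyshev radicals relative to $F$.
   Context: For an element $x$ of a ring and an integer $n\ge 0$, the $n$-th Chebyshev power $x^{\copyright n}$ is defined by $x^{\copyright 0}=2$, $x^{\copyright 1}=x$, $x^{\copyright n}=x\,x^{\copyright (n-1)}-x^{\copyright (n-2)}$. A univariate polynomial $P$ with coefficients in a field $F_0$ is solvable in Chebyshev radicals relative to $F_0$ if there is a tower of fields $F_0\subseteq F_1\subseteq\cdots\subseteq F_n$ such that $P$ factors completely into linear factors over $F_n$ and, for each $0<i\le n$, $F_i=F_{i-1}(r_i)$ with $r_i^{\copyright m_i}\in F_{i-1}$ for some positive integer $m_i$. *)

theory Defs
  imports "HOL-Algebra.Algebraic_Closure" "HOL-Algebra.Generated_Fields"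
begin

definition ring_char :: "('a, 'm) ring_scheme \<Rightarrow> nat" where
  "ring_char R =
     (if \<exists>n::nat. n > 0 \<and> [n] \<cdot>\<^bsub>R\<^esub> \<one>\<^bsub>R\<^esub> = \<zero>\<^bsub>R\<^esub> then LEAST n::nat. n > 0 \<and> [n] \<cdot>\<^bsub>R\<^esub> \<one>\<^bsub>R\<^esub> = \<zero>\<^bsub>R\<^esub> else 0)"

fun cheb_power :: "('a, 'm) ring_scheme \<Rightarrow> 'a \<Rightarrow> nat \<Rightarrow> 'a" where
  "cheb_power R x 0 = \<one>\<^bsub>R\<^esub> \<oplus>\<^bsub>R\<^esub> \<one>\<^bsub>R\<^esub>"
| "cheb_power R x (Suc 0) = x"
| "cheb_power R x (Suc (Suc n)) = (x \<otimes>\<^bsub>R\<^esub> cheb_power R x (Suc n)) \<ominus>\<^bsub>R\<^esub> cheb_power R x n"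

definition cheb_radical_tower :: "('a, 'm) ring_scheme \<Rightarrow> (nat \<Rightarrow> 'a set) \<Rightarrow> nat \<Rightarrow> bool" where
  "cheb_radical_tower L K n \<longleftrightarrow>
     (\<forall>i\<le>n. subfield (K i) L) \<and>
     (\<forall>i<n. K i \<subseteq> K (Suc i) \<and>
        (\<exists>r\<in>carrier L. \<exists>m>0.
           K (Suc i) = generate_field L (insert r (K i)) \<and> cheb_power L r m \<in> K i))"

(* The base field F is identified with its image under an embedding h into a field L which
   contains the whole tower.  L ranges over arbitrary fields on the type that the library uses
   for the algebraic closure of F.  Fixing this type loses no generality: every step of a tower
   adjoins a root of a monic polynomial, so the top of any tower is algebraic over F, hence of
   cardinality at most max(card F, aleph_0), and it has an isomorphic copy on this type.

   Polynomials are coefficient lists, leading coefficient first.  The coefficients are mapped by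
   h, and ring.splitted (all roots, with multiplicity, add up to the degree) is taken in the field
   with carrier K n.  The constant splitted_on is not suitable here: it ignores multiplicities and
   counts no roots at all when the subfield is infinite. *)
definition solvable_in_cheb_radicals :: "('a, 'm) ring_scheme \<Rightarrow> 'a list \<Rightarrow> bool" where
  "solvable_in_cheb_radicals F p \<longleftrightarrow>
     (\<exists>(L :: (('a list \<times> nat) multiset \<Rightarrow> 'a) ring) h K n.
        field L \<and> h \<in> ring_hom F L \<and> K 0 = h ` carrier F \<and>
        cheb_radical_tower L K n \<and>
        ring.splitted (L\<lparr>carrier := K n\<rparr>) (map h p))"

end

theory Submission
  imports Defs
begin

text \<open>
  Let \<open>y\<close> be a root of \<open>x\<^sup>2 + x + t\<close> in an algebraic closure \<open>L\<close> of \<open>F\<close>; the other root is \<open>y + 1\<close>,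
  so it is enough to place \<open>y\<close> on top of a tower of Chebyshev radical extensions.

  In characteristic two the third Chebyshev power is \<open>x\<^sup>3 + x\<close>, and for \<open>a \<noteq> 0\<close> the cubic
  \<open>x\<^sup>3 + x + a\<close> is separable, with a splitting field which contains a root of its quadratic resolvent
  \<open>w\<^sup>2 + a w + 1 + a\<^sup>2\<close>.  Put \<open>w = a (v + 1 / a)\<close>; then \<open>v\<^sup>2 + v + 1 + 1 / a = 0\<close>.  For \<open>t \<noteq> 1\<close> the
  choice \<open>a = 1 / (t + 1)\<close> turns this into the given polynomial.  Hence the roots of \<open>x\<^sup>2 + x + t\<close>
  lie in the field that is obtained by adjoining two roots \<open>r\<close>, \<open>s\<close> of \<open>x\<^sup>3 + x + a\<close>, and both of
  these have the third Chebyshev power \<open>a\<close>, which is in the base field.  Explicitly, if \<open>r\<close> is a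
  root of the cubic, then so is \<open>s = r (y + 1 / (r + 1)) + 1\<close>, and this equation can be solved for
  \<open>y\<close> (lemma \<open>second_cubic_root\<close>).

  For \<open>t = 1\<close> this choice of \<open>a\<close> is impossible.  But then \<open>y\<close> itself is a Chebyshev radical: it
  is \<open>u + 1 / u\<close> for a primitive fifth root of unity \<open>u\<close>, so its fifth Chebyshev power is \<open>1 + 1 = 0\<close>
  (lemma \<open>cheb_power_five_eq_zero\<close>).
\<close>

section \<open>Roots of polynomials over fields\<close>

lemma (in field) quadratic_with_root_splitted:
  assumes p: "p \<in> carrier (poly_ring R)" and deg: "degree p = 2"
    and a: "a \<in> carrier R" and root: "eval p a = \<zero>"
  shows "splitted p"
proof -
  have "p \<noteq> []"
    using deg by auto
  then have "[ \<one>, \<ominus> a ] pdivides p"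
    using is_root_imp_pdivides[OF p] a root unfolding is_root_def by simp
  then obtain q where q: "q \<in> carrier (poly_ring R)"
    and p_eq: "p = [ \<one>, \<ominus> a ] \<otimes>\<^bsub>poly_ring R\<^esub> q"
    unfolding pdivides_def by blast
  have in_carrier: "[ \<one>, \<ominus> a ] \<in> carrier (poly_ring R)"
    using a unfolding sym[OF univ_poly_carrier] polynomial_def by simp
  have "q \<noteq> []"
    using \<open>p \<noteq> []\<close> p_eq in_carrier q
      domain.integral_iff[OF univ_poly_is_domain[OF carrier_is_subring] in_carrier, of q]
    by (auto simp add: univ_poly_zero[of R "carrier R"])
  then have "degree p = Suc (degree q)"
    using poly_mult_degree_eq[OF carrier_is_subring, of "[ \<one>, \<ominus> a ]" q] in_carrier q p_eq
    unfolding univ_poly_carrier sym[OF univ_poly_mult[of R "carrier R"]] by auto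
  then have "size (roots q) = 1"
    using degree_one_imp_splitted[OF q] deg unfolding splitted_def by simp
  then show ?thesis
    using poly_mult_degree_one_monic_imp_same_roots[OF a q \<open>q \<noteq> []\<close>] p_eq deg
    unfolding splitted_def by simp
qed

lemma (in algebraically_closed) exists_root_of_nonconstant:
  assumes p: "p \<in> carrier (poly_ring L)" and deg: "degree p > 0"
  shows "\<exists>x \<in> carrier L. eval p x = \<zero>"
proof -
  have "roots p \<noteq> {#}"
    using roots_over_carrier[OF p] deg unfolding splitted_def by auto
  then show ?thesis
    using roots_mem_iff_is_root[OF p] unfolding is_root_def by (metis multiset_nonemptyE)
qed

section \<open>Extending Chebyshev radical towers\<close>

lemma cheb_radical_tower_trivial:
  assumes "subfield A L"
  shows "cheb_radical_tower L (\<lambda>_. A) 0"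
  using assms unfolding cheb_radical_tower_def by simp

lemma (in field) cheb_radical_tower_adjoin:
  assumes tower: "cheb_radical_tower R K n" and r: "r \<in> carrier R"
    and m: "m > 0" "cheb_power R r m \<in> K n"
  shows "cheb_radical_tower R (K(Suc n := generate_field R (insert r (K n)))) (Suc n)"
proof -
  have "subfield (K n) R"
    using tower unfolding cheb_radical_tower_def by simp
  then have incl: "insert r (K n) \<subseteq> carrier R"
    using subfieldE(3) r by auto
  have "K n \<subseteq> generate_field R (insert r (K n))"
    using generate_field.incl[of _ "insert r (K n)" R] by auto
  then show ?thesis
    using tower generate_field_is_subfield[OF incl] r m
    unfolding cheb_radical_tower_def by (auto simp: less_Suc_eq le_Suc_eq)
qed

section \<open>Chebyshev powers in characteristic two\<close>

text \<open>Fields of characteristic two; characteristic two is encoded as \<open>1 + 1 = 0\<close>.\<close>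

locale char_two_field = field R for R (structure) +
  assumes one_add_one: "\<one> \<oplus> \<one> = \<zero>"
begin

lemma add_self: "x \<in> carrier R \<Longrightarrow> x \<oplus> x = \<zero>"
  using l_distr[of \<one> \<one> x] one_add_one by simp

lemma add_self_left: "x \<in> carrier R \<Longrightarrow> y \<in> carrier R \<Longrightarrow> x \<oplus> (x \<oplus> y) = y"
  using add_self by (simp add: a_assoc[symmetric])

lemma uminus_eq: "x \<in> carrier R \<Longrightarrow> \<ominus> x = x"
  using add_self by (simp add: minus_equality)

lemma add_eq_zero_iff: "x \<in> carrier R \<Longrightarrow> y \<in> carrier R \<Longrightarrow> x \<oplus> y = \<zero> \<longleftrightarrow> x = y"
  using add_self uminus_eq minus_equality by metis

text \<open>
  Rewriting with these equations brings every polynomial expression with coefficients in the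
  prime field to a normal form, so it proves the polynomial identities of characteristic two.
\<close>

lemmas char_two_normalize =
  minus_eq uminus_eq l_distr r_distr m_ac a_ac add_self add_self_left

lemma cheb_power_three:
  assumes "x \<in> carrier R"
  shows "cheb_power R x 3 = x \<otimes> x \<otimes> x \<oplus> x"
  using assms by (simp add: numeral_eq_Suc char_two_normalize)

lemma cheb_power_five:
  assumes "x \<in> carrier R"
  shows "cheb_power R x 5 = x \<otimes> ((x \<otimes> x \<oplus> x \<oplus> \<one>) \<otimes> (x \<otimes> x \<oplus> x \<oplus> \<one>))"
  using assms by (simp add: numeral_eq_Suc char_two_normalize)

lemma cheb_power_five_eq_zero:
  assumes "y \<in> carrier R" and "y \<otimes> y \<oplus> y \<oplus> \<one> = \<zero>"
  shows "cheb_power R y 5 = \<zero>"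
  using assms cheb_power_five by simp

text \<open>
  Here \<open>c\<close> is the inverse of \<open>a\<close>.  The equation for \<open>r\<close> then says that
  \<open>d = c r (r + 1)\<close> is the inverse of \<open>r + 1\<close>, and that \<open>c (r + 1)\<^sup>2\<close> is the inverse of \<open>r\<close>; this
  avoids divisions.
\<close>

lemma second_cubic_root:
  assumes carr: "a \<in> carrier R" "c \<in> carrier R" "r \<in> carrier R" "y \<in> carrier R"
    and inv: "c \<otimes> a = \<one>"
    and r: "r \<otimes> r \<otimes> r \<oplus> r = a"
    and y: "y \<otimes> y \<oplus> y = c \<oplus> \<one>"
  defines "d \<equiv> c \<otimes> (r \<otimes> (r \<oplus> \<one>))"
  defines "s \<equiv> r \<otimes> (y \<oplus> d) \<oplus> \<one>"
  shows "s \<otimes> s \<otimes> s \<oplus> s = a"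
    and "y = (s \<oplus> \<one>) \<otimes> (c \<otimes> ((r \<oplus> \<one>) \<otimes> (r \<oplus> \<one>))) \<oplus> d"
proof -
  have d: "d \<in> carrier R" and s: "s \<in> carrier R"
    using carr unfolding d_def s_def by auto
  have d_inv: "d \<otimes> (r \<oplus> \<one>) = \<one>"
  proof -
    have "d \<otimes> (r \<oplus> \<one>) = c \<otimes> (r \<otimes> r \<otimes> r \<oplus> r)"
      unfolding d_def using carr by (simp add: char_two_normalize)
    then show ?thesis
      using r inv by simp
  qed
  have r_inv: "r \<otimes> (c \<otimes> ((r \<oplus> \<one>) \<otimes> (r \<oplus> \<one>))) = \<one>"
    using d_inv carr unfolding d_def by (simp add: m_ac)
  have dd: "d \<otimes> d = r \<otimes> c"
  proof -
    have "d \<otimes> d = r \<otimes> c \<otimes> (d \<otimes> (r \<oplus> \<one>))"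
      using carr d by (subst d_def) (simp add: m_ac)
    then show ?thesis
      using d_inv carr by simp
  qed
  have "r \<otimes> (c \<oplus> (d \<otimes> d \<oplus> d)) = d \<otimes> d \<oplus> r \<otimes> (d \<otimes> d \<oplus> d)"
    using carr d by (simp add: r_distr dd)
  also have "\<dots> = d \<otimes> (d \<otimes> (r \<oplus> \<one>)) \<oplus> r \<otimes> d"
    using carr d by (simp add: char_two_normalize)
  also have "\<dots> = d \<otimes> (r \<oplus> \<one>)"
    using carr d d_inv by (simp add: char_two_normalize)
  finally have e: "r \<otimes> (c \<oplus> (d \<otimes> d \<oplus> d)) = \<one>"
    using d_inv by simp
  \<comment> \<open>\<open>s\<close> is a root of \<open>(x\<^sup>3 + x + a) / (x + r)\<close>\<close>
  have "s \<otimes> s \<oplus> r \<otimes> s \<oplus> r \<otimes> r \<oplus> \<one>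
      = r \<otimes> r \<otimes> ((y \<otimes> y \<oplus> y) \<oplus> (d \<otimes> d \<oplus> d)) \<oplus> r \<oplus> r \<otimes> r"
    unfolding s_def using carr d by (simp add: char_two_normalize)
  also have "\<dots> = r \<otimes> (r \<otimes> (c \<oplus> (d \<otimes> d \<oplus> d))) \<oplus> r"
    unfolding y using carr d by (simp add: char_two_normalize)
  also have "\<dots> = \<zero>"
    unfolding e using carr by (simp add: add_self)
  finally have quot: "s \<otimes> s \<oplus> r \<otimes> s \<oplus> r \<otimes> r \<oplus> \<one> = \<zero>" .
  have "s \<otimes> s \<otimes> s \<oplus> s
      = (s \<oplus> r) \<otimes> (s \<otimes> s \<oplus> r \<otimes> s \<oplus> r \<otimes> r \<oplus> \<one>) \<oplus> (r \<otimes> r \<otimes> r \<oplus> r)"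
    using carr s by (simp add: char_two_normalize)
  then show "s \<otimes> s \<otimes> s \<oplus> s = a"
    unfolding quot r using carr s by simp
  let ?i = "c \<otimes> ((r \<oplus> \<one>) \<otimes> (r \<oplus> \<one>))"
  have "(s \<oplus> \<one>) \<otimes> ?i \<oplus> d = (y \<oplus> d) \<otimes> (r \<otimes> ?i) \<oplus> d"
  proof -
    have "s \<oplus> \<one> = (y \<oplus> d) \<otimes> r"
      unfolding s_def using carr d by (simp add: char_two_normalize)
    then show ?thesis
      using carr d by (simp add: m_assoc)
  qed
  then show "y = (s \<oplus> \<one>) \<otimes> ?i \<oplus> d"
    unfolding r_inv using carr d by (simp add: char_two_normalize)
qed

section \<open>A tower containing a root of the quadratic\<close>

text \<open>The case \<open>t = 1\<close>: one step, with fifth Chebyshev power \<open>0\<close>.\<close>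

lemma exists_tower_five:
  assumes A: "subfield A R" and y: "y \<in> carrier R" "y \<otimes> y \<oplus> y \<oplus> \<one> = \<zero>"
  shows "\<exists>K n. K 0 = A \<and> cheb_radical_tower R K n \<and> y \<in> K n"
proof -
  let ?K = "(\<lambda>_. A)(Suc 0 := generate_field R (insert y A))"
  have "cheb_power R y 5 \<in> A"
    using cheb_power_five_eq_zero[OF y] subringE(2)[OF subfieldE(1)[OF A]] by simp
  then have "cheb_radical_tower R ?K (Suc 0)"
    using cheb_radical_tower_adjoin[OF cheb_radical_tower_trivial[OF A] y(1), of 5] by simp
  moreover have "y \<in> ?K (Suc 0)"
    by (simp add: generate_field.incl)
  ultimately show ?thesis
    by (intro exI[of _ ?K] exI[of _ "Suc 0"]) simp
qed

text \<open>
  The case \<open>t = c + 1\<close> with \<open>c \<noteq> 0\<close>: two steps with third Chebyshev power \<open>a = 1 / c\<close>, which adjoin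
  two roots of the cubic \<open>x\<^sup>3 + x + a\<close>.
\<close>

lemma exists_tower_three:
  assumes A: "subfield A R" and a: "a \<in> A" and c: "c \<in> A" and inv: "c \<otimes> a = \<one>"
    and r: "r \<in> carrier R" "r \<otimes> r \<otimes> r \<oplus> r = a"
    and y: "y \<in> carrier R" "y \<otimes> y \<oplus> y = c \<oplus> \<one>"
  shows "\<exists>K n. K 0 = A \<and> cheb_radical_tower R K n \<and> y \<in> K n"
proof -
  have carr: "a \<in> carrier R" "c \<in> carrier R"
    using a c subfieldE(3)[OF A] by auto
  define d where "d = c \<otimes> (r \<otimes> (r \<oplus> \<one>))"
  define s where "s = r \<otimes> (y \<oplus> d) \<oplus> \<one>"
  have s: "s \<in> carrier R"
    using carr r y unfolding s_def d_def by simp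
  note cubic = second_cubic_root[OF carr r(1) y(1) inv r(2) y(2), folded d_def, folded s_def]
  define B where "B = generate_field R (insert r A)"
  define C where "C = generate_field R (insert s B)"
  let ?K1 = "(\<lambda>_. A)(Suc 0 := B)"
  let ?K2 = "?K1(Suc (Suc 0) := C)"
  have "cheb_radical_tower R ?K1 (Suc 0)"
    using cheb_radical_tower_adjoin[OF cheb_radical_tower_trivial[OF A] r(1), of 3]
      cheb_power_three[OF r(1)] r(2) a unfolding B_def by simp
  moreover have AB: "A \<subseteq> B" "r \<in> B"
    unfolding B_def by (auto intro: generate_field.incl)
  ultimately have tower: "cheb_radical_tower R ?K2 (Suc (Suc 0))"
    using cheb_radical_tower_adjoin[of ?K1 "Suc 0" s 3] s
      cheb_power_three[OF s] cubic(1) a unfolding C_def by auto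
  then have "subfield C R"
    unfolding cheb_radical_tower_def by auto
  then have sub: "subring C R"
    by (rule subfieldE(1))
  have BC: "B \<subseteq> C" "s \<in> C"
    unfolding C_def by (auto intro: generate_field.incl)
  then have "r \<in> C" "c \<in> C"
    using AB c by auto
  then have "y \<in> C"
    using BC(2) by (subst cubic(2)) (simp add: d_def subringE[OF sub])
  then show ?thesis
    using tower by (intro exI[of _ ?K2] exI[of _ "Suc (Suc 0)"]) simp
qed

end

lemma (in algebraically_closed) exists_tower_root:
  assumes two: "\<one> \<oplus> \<one> = \<zero>" and A: "subfield A L" and t: "t \<in> A"
  shows "\<exists>K n. \<exists>y\<in>K n. K 0 = A \<and> cheb_radical_tower L K n \<and> y \<otimes> y \<oplus> y \<oplus> t = \<zero>"
proof -
  interpret char_two_field L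
    using two by unfold_locales
  note sub = subfieldE(1)[OF A]
  have tL: "t \<in> carrier L"
    using t subfieldE(3)[OF A] by auto
  have "[ \<one>, \<one>, t ] \<in> carrier (poly_ring L)"
    using tL unfolding sym[OF univ_poly_carrier] polynomial_def by simp
  from exists_root_of_nonconstant[OF this] obtain y
    where y: "y \<in> carrier L" and "eval [ \<one>, \<one>, t ] y = \<zero>"
    by auto
  then have y_root: "y \<otimes> y \<oplus> y \<oplus> t = \<zero>"
    using tL by (simp add: numeral_eq_Suc a_assoc)
  have "\<exists>K n. K 0 = A \<and> cheb_radical_tower L K n \<and> y \<in> K n"
  proof (cases "t = \<one>")
    case True
    then show ?thesis
      using exists_tower_five[OF A y] y_root by simp
  next
    case False
    define c where "c = t \<oplus> \<one>"
    have "c \<noteq> \<zero>"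
      using False tL unfolding c_def by (simp add: add_eq_zero_iff)
    moreover have c: "c \<in> A" "c \<in> carrier L"
      using t tL subringE(3,7)[OF sub] unfolding c_def by auto
    ultimately have "inv c \<in> A" and inv: "c \<otimes> inv c = \<one>"
      using subfield_m_inv[OF A, of c] by auto
    then have a: "inv c \<in> carrier L"
      using subfieldE(3)[OF A] by auto
    have "[ \<one>, \<zero>, \<one>, inv c ] \<in> carrier (poly_ring L)"
      using a unfolding sym[OF univ_poly_carrier] polynomial_def by simp
    from exists_root_of_nonconstant[OF this] obtain r
      where r: "r \<in> carrier L" and "eval [ \<one>, \<zero>, \<one>, inv c ] r = \<zero>"
      by auto
    then have "(r \<otimes> r \<otimes> r \<oplus> r) \<oplus> inv c = \<zero>"
      using a by (simp add: numeral_eq_Suc a_assoc)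
    then have "r \<otimes> r \<otimes> r \<oplus> r = inv c"
      using r a by (simp add: add_eq_zero_iff)
    moreover have "y \<otimes> y \<oplus> y = c \<oplus> \<one>"
      using y_root y tL unfolding c_def by (simp add: add_eq_zero_iff char_two_normalize)
    ultimately show ?thesis
      using exists_tower_three[OF A \<open>inv c \<in> A\<close> c(1) inv r _ y] by simp
  qed
  then show ?thesis
    using y_root by blast
qed

lemma ring_char_two_imp_one_add_one:
  assumes "ring R" and "ring_char R = 2"
  shows "\<one>\<^bsub>R\<^esub> \<oplus>\<^bsub>R\<^esub> \<one>\<^bsub>R\<^esub> = \<zero>\<^bsub>R\<^esub>"
proof -
  interpret ring R
    by fact
  let ?P = "\<lambda>n::nat. n > 0 \<and> [n] \<cdot>\<^bsub>R\<^esub> \<one>\<^bsub>R\<^esub> = \<zero>\<^bsub>R\<^esub>"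
  have "\<exists>n. ?P n" and "(LEAST n. ?P n) = 2"
    using assms(2) unfolding ring_char_def by (auto split: if_splits)
  then have "?P 2"
    by (metis (mono_tags, lifting) LeastI_ex)
  then show ?thesis
    by (simp add: numeral_eq_Suc)
qed

theorem theorem73:
  fixes F :: "('a, 'm) ring_scheme" and t :: 'a
  assumes "field F"
    and "ring_char F = 2"
    and "t \<in> carrier F"
  shows "solvable_in_cheb_radicals F [\<one>\<^bsub>F\<^esub>, \<one>\<^bsub>F\<^esub>, t]"
proof -
  interpret F: field F
    by fact
  let ?h = "F.indexed_const"
  obtain L :: "(('a list \<times> nat) multiset \<Rightarrow> 'a) ring"
    where closure: "algebraic_closure L (?h ` carrier F)" and h: "?h \<in> ring_hom F L"
    using F.exists_closure by blast
  interpret L: algebraic_closure L "?h ` carrier F"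
    by (rule closure)
  have one: "?h \<one>\<^bsub>F\<^esub> = \<one>\<^bsub>L\<^esub>"
    using ring_hom_one[OF h] .
  have "\<one>\<^bsub>L\<^esub> \<oplus>\<^bsub>L\<^esub> \<one>\<^bsub>L\<^esub> = ?h (\<one>\<^bsub>F\<^esub> \<oplus>\<^bsub>F\<^esub> \<one>\<^bsub>F\<^esub>)"
    using ring_hom_add[OF h] one by simp
  also have "\<dots> = \<zero>\<^bsub>L\<^esub>"
    using ring_char_two_imp_one_add_one[OF F.ring_axioms assms(2)]
      ring_hom_zero[OF h F.ring_axioms L.ring_axioms] by simp
  finally obtain K n y where K0: "K 0 = ?h ` carrier F" and tower: "cheb_radical_tower L K n"
    and y: "y \<in> K n" and root: "y \<otimes>\<^bsub>L\<^esub> y \<oplus>\<^bsub>L\<^esub> y \<oplus>\<^bsub>L\<^esub> ?h t = \<zero>\<^bsub>L\<^esub>"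
    using L.exists_tower_root[OF _ L.subfield_axioms, of "?h t"] assms(3) by blast
  let ?p = "[\<one>\<^bsub>L\<^esub>, \<one>\<^bsub>L\<^esub>, ?h t]"
  have Kn: "subfield (K n) L"
    using tower unfolding cheb_radical_tower_def by simp
  interpret Kn: field "L\<lparr>carrier := K n\<rparr>"
    using L.subfield_iff(2)[OF Kn] .
  have "K 0 \<subseteq> K i" if "i \<le> n" for i
    using that
  proof (induction i)
    case (Suc i)
    then show ?case
      using tower unfolding cheb_radical_tower_def by (meson Suc_leD Suc_le_lessD subset_trans)
  qed simp
  then have t: "?h t \<in> K n"
    using K0 assms(3) by blast
  have in_L: "y \<in> carrier L" "?h t \<in> carrier L"
    using y t subfieldE(3)[OF Kn] by auto
  have "?p \<in> carrier (poly_ring (L\<lparr>carrier := K n\<rparr>))"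
    using t Kn.one_closed unfolding sym[OF univ_poly_carrier] polynomial_def by simp
  moreover have "Kn.eval ?p y = \<zero>\<^bsub>L\<^esub>"
    using L.eval_consistent[OF subfieldE(1)[OF Kn]] in_L root
    by (simp add: numeral_eq_Suc L.a_assoc)
  ultimately have "Kn.splitted ?p"
    using Kn.quadratic_with_root_splitted[of ?p y] y by simp
  then show ?thesis
    unfolding solvable_in_cheb_radicals_def
    using L.field_axioms h K0 tower one
    by (intro exI[of _ L] exI[of _ ?h] exI[of _ K] exI[of _ n]) simp
qed

end
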